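(* Let $D_v, D_c \ge 2$ be integers, $\varepsilon\in(0,1]$, and let $\rho(x)=\sum_{j=2}^{D_c}\rho_j x^{j-1}$ be a fixed polynomial with $\rho_j\ge 0$ and $\sum_{j=2}^{D_c}\rho_j=1$. For $\lambda=(\lambda_2,\dots,\lambda_{D_v})\in\mathbb{R}^{D_v-1}$ write $\lambda(x)=\sum_{i=2}^{D_v}\lambda_i x^{i-1}$, put $q=D_cD_v$, $P(x)=x-\lambda\bigl(1-\rho(1-\varepsilon x)\bigr)$ (a polynomial in $x$ of degree at most $q$), and let $\Pi_0,\dots,\Pi_{2q}$ be the coefficients (which depend affinely on $\lambda$) of the polynomial $$\Pi(x)=(1+x^2)^q\,P\!\left(\frac{x^2}{1+x^2}\right)=\sum_{l=0}^{2q}\Pi_l x^l .$$ Then the semi-infinite optimization problem $$\text{(NLP1)}\quad \max_{\lambda}\ \sum_{i=2}^{D_v}\frac{\lambda_i}{i}\quad\text{s.t.}\quad \lambda_i\ge 0,\ \ \sum_{i=2}^{D_v}\lambda_i=1,\ \ \sum_{i=2}^{D_v}\lambda_i\bigl(1-\rho(1-\varepsilon x)\bigr)^{i-1}\le x\ \ \forall x\in(0,1]$$ is equivalent to the semi-definite program $$\text{(SDP1)}\quad \max_{\lambda,B}\ \sum_{i=2}^{D_v}\frac{\lambda_i}{i}\quad\text{s.t.}\quad \sum_{i=2}^{D_v}\lambda_i=1,\ \ \Pi_l=\sum_{i+j=l}B_{ij}\ (0\le l\le 2q),\ \ B\succcurlyeq 0,\ \ 0\le\lambda_i\le 1,$$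 where $B=(B_{ij})_{0\le i,j\le q}$ ranges over real symmetric $(q+1)\times(q+1)$ matrices. That is, $\lambda$ is feasible for (NLP1) if and only if there exists $B$ such that $(\lambda,B)$ is feasible for (SDP1), the objective functions being the same.
   Context: $B\succcurlyeq 0$ means that the real symmetric matrix $B$ is positive semi-definite, i.e. $v^TBv\ge 0$ for every real vector $v$. Rows and columns of $B$ are indexed from $0$ to $q$, so in $\sum_{i+j=l}B_{ij}$ the sum runs over all pairs $(i,j)$ with $0\le i,j\le q$ and $i+j=l$. The polynomials $\lambda$ and $\rho$ are the variable-node and check-node edge degree distributions of an LDPC code ensemble with maximum variable-node degree $D_v$ and maximum check-node degree $D_c$, and $\varepsilon$ is the erasure probability of a binary erasure channel. *)

theory Defs
  imports "HOL-Analysis.Analysis" "HOL-Computational_Algebra.Polynomial"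
    "Jordan_Normal_Form.Matrix"
begin

text \<open>Families \<open>c\<^sub>2, \<dots>, c\<^sub>D\<close> are functions on \<^typ>\<open>nat\<close> whose values outside
  \<open>{2..D}\<close> are irrelevant.\<close>

definition edge_poly :: "nat \<Rightarrow> (nat \<Rightarrow> real) \<Rightarrow> real poly" where
  "edge_poly D c = (\<Sum>i=2..D. monom (c i) (i - 1))"

definition P_poly :: "nat \<Rightarrow> nat \<Rightarrow> real \<Rightarrow> (nat \<Rightarrow> real) \<Rightarrow> (nat \<Rightarrow> real) \<Rightarrow> real poly" where
  "P_poly D\<^sub>v D\<^sub>c \<epsilon> \<rho> lam =
     [:0, 1:] - (edge_poly D\<^sub>v lam \<circ>\<^sub>p (1 - (edge_poly D\<^sub>c \<rho> \<circ>\<^sub>p [:1, - \<epsilon>:])))"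

text \<open>The polynomial given by \<open>(1 + x\<^sup>2)\<^sup>q P(x\<^sup>2 / (1 + x\<^sup>2))\<close>.  It exists
  whenever \<open>degree P \<le> q\<close> (\<open>subst_poly\<close> below) and then has degree at most \<open>2q\<close>.\<close>

definition subst_poly :: "nat \<Rightarrow> real poly \<Rightarrow> real poly" where
  "subst_poly q P = (THE p. \<forall>x. poly p x = (1 + x\<^sup>2) ^ q * poly P (x\<^sup>2 / (1 + x\<^sup>2)))"

definition Pi_poly :: "nat \<Rightarrow> nat \<Rightarrow> real \<Rightarrow> (nat \<Rightarrow> real) \<Rightarrow> (nat \<Rightarrow> real) \<Rightarrow> real poly" where
  "Pi_poly D\<^sub>v D\<^sub>c \<epsilon> \<rho> lam = subst_poly (D\<^sub>c * D\<^sub>v) (P_poly D\<^sub>v D\<^sub>c \<epsilon> \<rho> lam)"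

definition psd_mat :: "nat \<Rightarrow> real mat \<Rightarrow> bool" where
  "psd_mat n B \<longleftrightarrow> B \<in> carrier_mat n n \<and> transpose_mat B = B \<and>
     (\<forall>v\<in>carrier_vec n. scalar_prod v (B *\<^sub>v v) \<ge> 0)"

definition objective :: "nat \<Rightarrow> (nat \<Rightarrow> real) \<Rightarrow> real" where
  "objective D\<^sub>v lam = (\<Sum>i=2..D\<^sub>v. lam i / real i)"

definition NLP1_feasible ::
  "nat \<Rightarrow> nat \<Rightarrow> real \<Rightarrow> (nat \<Rightarrow> real) \<Rightarrow> (nat \<Rightarrow> real) \<Rightarrow> bool" where
  "NLP1_feasible D\<^sub>v D\<^sub>c \<epsilon> \<rho> lam \<longleftrightarrow>
     (\<forall>i\<in>{2..D\<^sub>v}. lam i \<ge> 0) \<and> (\<Sum>i=2..D\<^sub>v. lam i) = 1 \<and>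
     (\<forall>x\<in>{0<..1}. (\<Sum>i=2..D\<^sub>v. lam i * (1 - poly (edge_poly D\<^sub>c \<rho>) (1 - \<epsilon> * x)) ^ (i - 1)) \<le> x)"

definition SDP1_feasible ::
  "nat \<Rightarrow> nat \<Rightarrow> real \<Rightarrow> (nat \<Rightarrow> real) \<Rightarrow> (nat \<Rightarrow> real) \<times> real mat \<Rightarrow> bool" where
  "SDP1_feasible D\<^sub>v D\<^sub>c \<epsilon> \<rho> = (\<lambda>(lam, B). let q = D\<^sub>c * D\<^sub>v in
     (\<Sum>i=2..D\<^sub>v. lam i) = 1 \<and>
     (\<forall>l\<le>2 * q. coeff (Pi_poly D\<^sub>v D\<^sub>c \<epsilon> \<rho> lam) l =
        (\<Sum>(i, j) | i \<le> q \<and> j \<le> q \<and> i + j = l. B $$ (i, j))) \<and>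
     psd_mat (q + 1) B \<and>
     (\<forall>i\<in>{2..D\<^sub>v}. 0 \<le> lam i \<and> lam i \<le> 1))"

definition NLP1_optimal ::
  "nat \<Rightarrow> nat \<Rightarrow> real \<Rightarrow> (nat \<Rightarrow> real) \<Rightarrow> (nat \<Rightarrow> real) \<Rightarrow> bool" where
  "NLP1_optimal D\<^sub>v D\<^sub>c \<epsilon> \<rho> = is_arg_max (objective D\<^sub>v) (NLP1_feasible D\<^sub>v D\<^sub>c \<epsilon> \<rho>)"

definition SDP1_optimal ::
  "nat \<Rightarrow> nat \<Rightarrow> real \<Rightarrow> (nat \<Rightarrow> real) \<Rightarrow> (nat \<Rightarrow> real) \<times> real mat \<Rightarrow> bool" where
  "SDP1_optimal D\<^sub>v D\<^sub>c \<epsilon> \<rho> =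
     is_arg_max (\<lambda>(lam, B). objective D\<^sub>v lam) (SDP1_feasible D\<^sub>v D\<^sub>c \<epsilon> \<rho>)"

lemma degree_edge_poly: "degree (edge_poly D c) \<le> D - 1"
  unfolding edge_poly_def
  by (rule degree_sum_le) (auto intro: order.trans[OF degree_monom_le])

lemma degree_P_poly:
  assumes "D\<^sub>v \<ge> 2" "D\<^sub>c \<ge> 2"
  shows "degree (P_poly D\<^sub>v D\<^sub>c \<epsilon> \<rho> lam) \<le> D\<^sub>c * D\<^sub>v"
proof -
  have "degree (edge_poly D\<^sub>c \<rho> \<circ>\<^sub>p [:1, - \<epsilon>:]) \<le> (D\<^sub>c - 1) * 1"
    unfolding degree_pcompose by (rule mult_le_mono[OF degree_edge_poly]) simp
  hence 1: "degree (1 - edge_poly D\<^sub>c \<rho> \<circ>\<^sub>p [:1, - \<epsilon>:]) \<le> D\<^sub>c - 1"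
    by (intro degree_diff_le) auto
  have "degree (edge_poly D\<^sub>v lam \<circ>\<^sub>p (1 - edge_poly D\<^sub>c \<rho> \<circ>\<^sub>p [:1, - \<epsilon>:])) \<le> (D\<^sub>v - 1) * (D\<^sub>c - 1)"
    unfolding degree_pcompose by (rule mult_le_mono[OF degree_edge_poly 1])
  also have "\<dots> \<le> D\<^sub>v * D\<^sub>c" by (intro mult_le_mono) auto
  also have "\<dots> = D\<^sub>c * D\<^sub>v" by simp
  finally have 2: "degree (edge_poly D\<^sub>v lam \<circ>\<^sub>p (1 - edge_poly D\<^sub>c \<rho> \<circ>\<^sub>p [:1, - \<epsilon>:])) \<le> D\<^sub>c * D\<^sub>v" .
  have "1 \<le> D\<^sub>c * D\<^sub>v" using assms by simp
  thus ?thesis unfolding P_poly_def using 2 by (intro degree_diff_le) auto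
qed

lemma subst_poly:
  assumes "degree P \<le> q"
  shows "poly (subst_poly q P) x = (1 + x\<^sup>2) ^ q * poly P (x\<^sup>2 / (1 + x\<^sup>2))"
    and "degree (subst_poly q P) \<le> 2 * q"
proof -
  define p where
    "p = (\<Sum>k\<le>degree P. [:coeff P k:] * (monom 1 (2 * k) * [:1, 0, 1:] ^ (q - k)))"
  have p: "poly p x = (1 + x\<^sup>2) ^ q * poly P (x\<^sup>2 / (1 + x\<^sup>2))" for x
  proof -
    have "x ^ (2 * k) * (1 + x\<^sup>2) ^ (q - k) = (1 + x\<^sup>2) ^ q * (x\<^sup>2 / (1 + x\<^sup>2)) ^ k"
      if "k \<le> degree P" for k
    proof -
      have "1 + x\<^sup>2 \<noteq> 0" by (smt (verit) zero_le_power2)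
      moreover have "(1 + x\<^sup>2) ^ q = (1 + x\<^sup>2) ^ (q - k) * (1 + x\<^sup>2) ^ k"
        using that assms by (simp flip: power_add)
      ultimately show ?thesis by (simp add: power_divide power_mult)
    qed
    thus ?thesis
      unfolding p_def poly_altdef[of P] sum_distrib_left poly_sum
      by (intro sum.cong) (auto simp: poly_monom power2_eq_square)
  qed
  have eq: "subst_poly q P = p"
    unfolding subst_poly_def
    by (rule the_equality) (use p in \<open>auto simp: poly_eq_poly_eq_iff[symmetric]\<close>)
  show "poly (subst_poly q P) x = (1 + x\<^sup>2) ^ q * poly P (x\<^sup>2 / (1 + x\<^sup>2))"
    using p eq by simp
  have "degree ([:coeff P k:] * (monom 1 (2 * k) * [:1, 0, 1:] ^ (q - k))) \<le> 2 * q"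
    if "k \<le> degree P" for k
  proof -
    have "degree ([:1, 0, 1::real:] ^ (q - k)) \<le> 2 * (q - k)"
      using degree_power_le[of "[:1, 0, 1::real:]" "q - k"] by simp
    moreover have "degree (monom (1::real) (2 * k)) \<le> 2 * k" by (rule degree_monom_le)
    ultimately have "degree (monom 1 (2 * k) * [:1, 0, 1::real:] ^ (q - k)) \<le> 2 * k + 2 * (q - k)"
      by (meson add_mono degree_mult_le order.trans)
    also have "\<dots> = 2 * q" using that assms by simp
    finally have "degree (monom 1 (2 * k) * [:1, 0, 1::real:] ^ (q - k)) \<le> 2 * q" .
    thus ?thesis using degree_mult_le[of "[:coeff P k:]" "monom 1 (2 * k) * [:1, 0, 1::real:] ^ (q - k)"]
      by simp
  qed
  thus "degree (subst_poly q P) \<le> 2 * q"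
    unfolding eq p_def by (intro degree_sum_le) auto
qed

end

theory Submission
  imports Defs "HOL-Computational_Algebra.Fundamental_Theorem_Algebra"
    "Jordan_Normal_Form.Char_Poly"
begin

text \<open>As \<open>t\<close> runs through the reals, \<open>t\<^sup>2 / (1 + t\<^sup>2)\<close> runs through \<open>[0, 1)\<close>, so by continuity the
  constraint of (NLP1), namely \<open>P \<ge> 0\<close> on \<open>(0, 1]\<close>, says that \<open>\<Pi> \<ge> 0\<close> on the whole line.  A nonnegative
  real polynomial is a sum of two squares \<open>f\<^sup>2 + g\<^sup>2\<close>: split off the factors \<open>(x - a)\<^sup>2 + b\<^sup>2\<close> given by
  its complex roots \<open>a \<plusminus> ib\<close> and use that sums of two squares are closed under products.  Then
  \<open>B = f f\<^sup>T + g g\<^sup>T\<close>, formed from the coefficient vectors, is the required matrix; conversely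
  \<open>\<Pi>(x) = v\<^sup>T B v\<close> for \<open>v = (1, x, \<dots>, x\<^sup>q)\<close>.\<close>

section \<open>Nonnegative real polynomials as sums of two squares\<close>

lemma poly_nonneg_limit:
  fixes p :: "real poly"
  assumes "at a within S \<noteq> bot" and "\<And>x. x \<in> S \<Longrightarrow> x \<noteq> a \<Longrightarrow> 0 \<le> poly p x"
  shows "0 \<le> poly p a"
proof (rule tendsto_lowerbound)
  show "(poly p \<longlongrightarrow> poly p a) (at a within S)"
    by (rule tendsto_intros) auto
  show "\<forall>\<^sub>F x in at a within S. 0 \<le> poly p x"
    using assms(2) by (auto simp: eventually_at_filter)
qed (use assms(1) in auto)

text \<open>A root of a nonnegative polynomial is a minimum, so the derivative vanishes there too
  and the root is at least double. The square of x - a is written expanded to match the quadratic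
  factor for \<open>b = 0\<close> in the induction below.\<close>

lemma nonneg_poly_root_twice:
  fixes p :: "real poly"
  assumes nn: "\<And>x. 0 \<le> poly p x" and "poly p a = 0"
  shows "[:a\<^sup>2, - 2 * a, 1:] dvd p"
proof -
  obtain r where p: "p = [:-a, 1:] * r"
    using assms(2) by (auto simp: poly_eq_0_iff_dvd elim: dvdE)
  have "poly (pderiv p) a = 0"
    using DERIV_local_min[OF poly_DERIV, of 1 a p] nn assms(2) by auto
  hence "poly r a = 0"
    unfolding p pderiv_mult by (simp add: pderiv_pCons)
  then obtain s where r: "r = [:-a, 1:] * s"
    by (auto simp: poly_eq_0_iff_dvd elim: dvdE)
  have "p = [:a\<^sup>2, - 2 * a, 1:] * s"
    unfolding p r mult.assoc[symmetric] by (simp add: power2_eq_square)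
  thus ?thesis by (rule dvdI)
qed

text \<open>The divisor is (x - z)(x - cnj z). It vanishes at z, hence so does the remainder of
  \<open>p\<close> modulo it; but a real polynomial of degree at most 1 with a non-real root is
  zero.\<close>

lemma poly_cnj_pair_dvd:
  fixes p :: "real poly"
  assumes z: "poly (map_poly complex_of_real p) z = 0" and "Im z \<noteq> 0"
  shows "[:(Re z)\<^sup>2 + (Im z)\<^sup>2, - 2 * Re z, 1:] dvd p"
proof -
  interpret map_poly_comm_ring_hom complex_of_real ..
  define d :: "real poly" where "d = [:(Re z)\<^sup>2 + (Im z)\<^sup>2, - 2 * Re z, 1:]"
  define r where "r = p mod d"
  have "d \<noteq> 0" "degree d = 2" by (auto simp: d_def)
  hence "degree r \<le> 1"
    using degree_mod_less[of d p] by (auto simp: r_def)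
  hence r: "r = [:coeff r 0, coeff r 1:]"
    by (auto simp: poly_eq_iff coeff_pCons coeff_eq_0 split: nat.splits)
  have "poly (map_poly complex_of_real d) z = 0"
    by (simp add: d_def map_poly_pCons complex_eq_iff power2_eq_square algebra_simps)
  moreover have "p = d * (p div d) + r" by (simp add: r_def)
  hence "map_poly complex_of_real p =
      map_poly complex_of_real d * map_poly complex_of_real (p div d) + map_poly complex_of_real r"
    by (simp only: hom_add[symmetric] hom_mult[symmetric])
  ultimately have "poly (map_poly complex_of_real [:coeff r 0, coeff r 1:]) z = 0"
    using z r by simp
  \<comment> \<open>The imaginary part of r0 + r1 z = 0 is r1 Im z = 0, which kills r1; the real
    part then kills r0.\<close>
  hence "coeff r 0 = 0" "coeff r 1 = 0"
    using \<open>Im z \<noteq> 0\<close> by (auto simp: of_real_hom.map_poly_pCons_hom complex_eq_iff)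
  hence "r = 0" using r by simp
  thus ?thesis unfolding r_def d_def by auto
qed

text \<open>Strong induction on the degree. The degree bounds are carried along so that, when
  \<open>p\<close> has degree at most 2q, the coefficient vectors of \<open>f\<close> and
  \<open>g\<close> fit into length q + 1.\<close>

lemma nonneg_poly_sum_two_squares:
  fixes p :: "real poly"
  assumes "\<And>x. 0 \<le> poly p x"
  shows "\<exists>f g. p = f\<^sup>2 + g\<^sup>2 \<and> 2 * degree f \<le> degree p \<and> 2 * degree g \<le> degree p"
  using assms
proof (induction "degree p" arbitrary: p rule: less_induct)
  case less
  show ?case
  proof (cases "degree p = 0")
    case True
    then obtain c where c: "p = [:c:]" by (auto elim: degree_eq_zeroE)
    with less.prems[of 0] have "p = [:sqrt c:]\<^sup>2 + 0\<^sup>2"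
      by (simp add: power2_eq_square)
    thus ?thesis by (metis degree_pCons_0 degree_0 mult_0_right le0)
  next
    case False
    have "\<not> constant (poly (map_poly complex_of_real p))"
      using False by (simp add: constant_degree degree_map_poly)
    then obtain z where z: "poly (map_poly complex_of_real p) z = 0"
      using fundamental_theorem_of_algebra by blast
    define a b where "a = Re z" and "b = Im z"
    have d: "[:a\<^sup>2 + b\<^sup>2, - 2 * a, 1:] dvd p"
    proof (cases "b = 0")
      case True
      hence "z = complex_of_real a" by (simp add: a_def b_def complex_eq_iff)
      hence "complex_of_real (poly p a) = 0" using z by (simp only: of_real_hom.poly_map_poly)
      hence "poly p a = 0" by simp
      thus ?thesis using nonneg_poly_root_twice less.prems True by simp
    next
      case False
      thus ?thesis using poly_cnj_pair_dvd[OF z] by (simp add: a_def b_def)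
    qed
    then obtain s where s: "p = [:a\<^sup>2 + b\<^sup>2, - 2 * a, 1:] * s" by (auto elim: dvdE)
    \<comment> \<open>For \<open>b = 0\<close> the quadratic factor vanishes at \<open>a\<close>, so
      dividing by it says nothing there; that point is recovered by continuity.\<close>
    have s_nn: "0 \<le> poly s x" if "x \<noteq> a" for x
    proof -
      have "0 < (x - a)\<^sup>2 + b\<^sup>2" using that by (simp add: sum_power2_gt_zero_iff)
      moreover have "poly p x = ((x - a)\<^sup>2 + b\<^sup>2) * poly s x"
        by (simp add: s power2_eq_square algebra_simps)
      ultimately show ?thesis using less.prems[of x] by (simp add: zero_le_mult_iff)
    qed
    have "0 \<le> poly s x" for x
      using s_nn poly_nonneg_limit[of a UNIV s] by (cases "x = a") auto
    moreover have deg: "degree p = degree s + 2"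
    proof -
      have "s \<noteq> 0" using False s by auto
      thus ?thesis by (simp add: s degree_mult_eq del: mult_pCons_left)
    qed
    ultimately obtain f g where fg: "s = f\<^sup>2 + g\<^sup>2" "2 * degree f \<le> degree s" "2 * degree g \<le> degree s"
      using less.hyps[of s] by auto
    \<comment> \<open>Real and imaginary parts of ((x - a) + ib)(f + ig); multiplicativity of the
      squared modulus gives the identity for \<open>p\<close>.\<close>
    define u v where "u = [:-a, 1:] * f - [:b:] * g" and "v = [:b:] * f + [:-a, 1:] * g"
    have q: "[:a\<^sup>2 + b\<^sup>2, - 2 * a, 1:] = [:-a, 1:]\<^sup>2 + [:b:]\<^sup>2"
      by (simp add: power2_eq_square)
    have "(A\<^sup>2 + C\<^sup>2) * (f\<^sup>2 + g\<^sup>2) = (A * f - C * g)\<^sup>2 + (C * f + A * g)\<^sup>2" for A C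
      by (simp add: power2_eq_square algebra_simps)
    hence "p = u\<^sup>2 + v\<^sup>2"
      unfolding s q fg(1) u_def v_def .
    moreover have "degree ([:-a, 1:] * h) \<le> degree s div 2 + 1" "degree ([:b:] * h) \<le> degree s div 2 + 1"
      if "2 * degree h \<le> degree s" for h
      using that degree_mult_le[of "[:-a, 1:]" h] degree_mult_le[of "[:b:]" h] by simp_all
    hence "degree u \<le> degree s div 2 + 1" "degree v \<le> degree s div 2 + 1"
      unfolding u_def v_def using fg(2,3) by (auto intro: degree_diff_le degree_add_le)
    hence "2 * degree u \<le> degree p" "2 * degree v \<le> degree p"
      unfolding deg by linarith+
    ultimately show ?thesis by blast
  qed
qed

section \<open>Gram matrices of nonnegative polynomials\<close>

text \<open>Grouping the entries by antidiagonals i + j = l turns the quadratic form at (1, x, ...,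
  x^n) into a polynomial in x.\<close>

lemma sum_convolution:
  fixes F :: "nat \<Rightarrow> nat \<Rightarrow> 'a::comm_semiring_1"
  shows "(\<Sum>l\<le>2 * n. (\<Sum>(i, j) | i \<le> n \<and> j \<le> n \<and> i + j = l. F i j) * x ^ l)
    = (\<Sum>i\<le>n. \<Sum>j\<le>n. F i j * x ^ i * x ^ j)"
proof -
  have "(\<Sum>i\<le>n. \<Sum>j\<le>n. F i j * x ^ i * x ^ j)
      = (\<Sum>p\<in>{..n} \<times> {..n}. F (fst p) (snd p) * x ^ (fst p + snd p))"
    by (simp add: sum.cartesian_product case_prod_beta power_add mult.assoc)
  also have "\<dots> = (\<Sum>l\<le>2 * n. \<Sum>p | p \<in> {..n} \<times> {..n} \<and> fst p + snd p = l.
      F (fst p) (snd p) * x ^ (fst p + snd p))"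
    by (rule sum.group[symmetric]) auto
  also have "\<dots> = (\<Sum>l\<le>2 * n. (\<Sum>(i, j) | i \<le> n \<and> j \<le> n \<and> i + j = l. F i j) * x ^ l)"
    unfolding sum_distrib_right
    by (intro sum.cong) (auto simp: case_prod_beta)
  finally show ?thesis by simp
qed

lemma quadratic_form_eq_sum:
  fixes B :: "'a::comm_semiring_1 mat"
  assumes "B \<in> carrier_mat n n" "v \<in> carrier_vec n"
  shows "scalar_prod v (B *\<^sub>v v) = (\<Sum>i<n. \<Sum>j<n. B $$ (i, j) * v $ i * v $ j)"
  using assms
  by (auto simp: scalar_prod_def sum_distrib_left atLeast0LessThan mult.left_commute mult.commute mult.assoc intro!: sum.cong)

lemma nonneg_poly_iff_psd_gram:
  fixes p :: "real poly"
  assumes "degree p \<le> 2 * q"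
  shows "(\<forall>x. 0 \<le> poly p x) \<longleftrightarrow>
    (\<exists>B. psd_mat (q + 1) B \<and>
      (\<forall>l\<le>2 * q. coeff p l = (\<Sum>(i, j) | i \<le> q \<and> j \<le> q \<and> i + j = l. B $$ (i, j))))"
proof
  assume "\<exists>B. psd_mat (q + 1) B \<and>
      (\<forall>l\<le>2 * q. coeff p l = (\<Sum>(i, j) | i \<le> q \<and> j \<le> q \<and> i + j = l. B $$ (i, j)))"
  then obtain B where B: "psd_mat (q + 1) B"
    and c: "\<And>l. l \<le> 2 * q \<Longrightarrow> coeff p l = (\<Sum>(i, j) | i \<le> q \<and> j \<le> q \<and> i + j = l. B $$ (i, j))"
    by blast
  show "\<forall>x. 0 \<le> poly p x"
  proof
    fix x :: real
    define v where "v = vec (q + 1) (\<lambda>i. x ^ i)"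
    have "poly p x = (\<Sum>l\<le>2 * q. coeff p l * x ^ l)"
      unfolding poly_altdef using assms
      by (intro sum.mono_neutral_left) (auto simp: coeff_eq_0)
    also have "\<dots> = (\<Sum>i\<le>q. \<Sum>j\<le>q. B $$ (i, j) * x ^ i * x ^ j)"
      unfolding sum_convolution[symmetric] by (simp add: c)
    also have "\<dots> = scalar_prod v (B *\<^sub>v v)"
      using B by (subst quadratic_form_eq_sum)
        (auto simp: psd_mat_def v_def lessThan_Suc_atMost intro!: sum.cong)
    also have "\<dots> \<ge> 0" using B by (auto simp: psd_mat_def v_def)
    finally show "0 \<le> poly p x" .
  qed
next
  assume "\<forall>x. 0 \<le> poly p x"
  then obtain f g where p: "p = f\<^sup>2 + g\<^sup>2" and "2 * degree f \<le> degree p" "2 * degree g \<le> degree p"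
    using nonneg_poly_sum_two_squares by blast
  hence deg: "degree f \<le> q" "degree g \<le> q" using assms by auto
  define B where "B = mat (q + 1) (q + 1) (\<lambda>(i, j). coeff f i * coeff f j + coeff g i * coeff g j)"
  have "scalar_prod v (B *\<^sub>v v) \<ge> 0" if v: "v \<in> carrier_vec (q + 1)" for v
  proof -
    have "scalar_prod v (B *\<^sub>v v) =
        (\<Sum>i<q+1. coeff f i * v $ i)\<^sup>2 + (\<Sum>i<q+1. coeff g i * v $ i)\<^sup>2"
      unfolding power2_eq_square sum_product sum.distrib[symmetric]
      using v by (subst quadratic_form_eq_sum)
        (auto simp: B_def algebra_simps intro!: sum.cong)
    thus ?thesis by simp
  qed
  hence "psd_mat (q + 1) B"
    unfolding psd_mat_def by (auto simp: B_def algebra_simps)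
  moreover have "coeff (h\<^sup>2) l = (\<Sum>(i, j) | i \<le> q \<and> j \<le> q \<and> i + j = l. coeff h i * coeff h j)"
    if "degree h \<le> q" for h :: "real poly" and l
  proof -
    have "coeff (h\<^sup>2) l = (\<Sum>i\<le>l. coeff h i * coeff h (l - i))"
      by (simp add: power2_eq_square coeff_mult)
    also have "\<dots> = (\<Sum>(i, j) | i + j = l. coeff h i * coeff h j)"
      by (rule sum.reindex_bij_witness[of _ fst "\<lambda>i. (i, l - i)"]) auto
    \<comment> \<open>A pair outside the square has an index above q, hence above the degree of
      \<open>h\<close>, so its term is zero.\<close>
    also have "\<dots> = (\<Sum>(i, j) | i \<le> q \<and> j \<le> q \<and> i + j = l. coeff h i * coeff h j)"
    proof (rule sum.mono_neutral_right)
      show "finite {(i, j). i + j = l}"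
        by (rule finite_subset[of _ "{..l} \<times> {..l}"]) auto
    qed (use that in \<open>auto dest!: le_degree\<close>)
    finally show ?thesis .
  qed
  hence "coeff p l = (\<Sum>(i, j) | i \<le> q \<and> j \<le> q \<and> i + j = l. B $$ (i, j))" for l
    unfolding p coeff_add using deg
    by (auto simp: B_def case_prod_beta sum.distrib[symmetric] intro!: sum.cong)
  ultimately show "\<exists>B. psd_mat (q + 1) B \<and>
      (\<forall>l\<le>2 * q. coeff p l = (\<Sum>(i, j) | i \<le> q \<and> j \<le> q \<and> i + j = l. B $$ (i, j)))"
    by blast
qed

section \<open>The substitution and the equivalence of the two programs\<close>

lemma subst_poly_nonneg_iff:
  assumes "degree P \<le> q"
  shows "(\<forall>t. 0 \<le> poly (subst_poly q P) t) \<longleftrightarrow> (\<forall>x\<in>{0<..1}. 0 \<le> poly P x)"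
proof
  assume nn: "\<forall>t. 0 \<le> poly (subst_poly q P) t"
  have P_nn: "0 \<le> poly P x" if "x \<in> {0<..<1}" for x
  proof -
    \<comment> \<open>The nonnegative solution of t^2 / (1 + t^2) = x.\<close>
    define t where "t = sqrt (x / (1 - x))"
    have "t\<^sup>2 = x / (1 - x)" using that by (simp add: t_def)
    hence "1 + t\<^sup>2 = 1 / (1 - x)" using that by (simp add: field_simps)
    hence "t\<^sup>2 / (1 + t\<^sup>2) = x" using \<open>t\<^sup>2 = x / (1 - x)\<close> that by simp
    moreover have "0 < (1 + t\<^sup>2) ^ q" by (simp add: add_pos_nonneg)
    ultimately show ?thesis
      using nn[rule_format, of t] by (simp add: subst_poly(1)[OF assms] zero_le_mult_iff)
  qed
  \<comment> \<open>The point 1 corresponds to infinite t and is reached only as a limit from the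
    left.\<close>
  moreover have "at (1::real) within {0<..<1} \<noteq> bot"
    by (simp add: at_within_eq_bot_iff)
  hence "0 \<le> poly P 1"
    using P_nn by (rule poly_nonneg_limit)
  ultimately show "\<forall>x\<in>{0<..1}. 0 \<le> poly P x"
    by (metis greaterThanAtMost_iff greaterThanLessThan_iff order_le_less)
next
  assume nn: "\<forall>x\<in>{0<..1}. 0 \<le> poly P x"
  \<comment> \<open>The value 0, taken at t = 0, lies outside the constraint interval and is reached
    as a limit from the right.\<close>
  have "at (0::real) within {0<..1} \<noteq> bot"
    by (simp add: at_within_eq_bot_iff)
  hence "0 \<le> poly P 0"
    by (rule poly_nonneg_limit) (use nn in auto)
  hence "0 \<le> poly P (t\<^sup>2 / (1 + t\<^sup>2))" for t
    using nn by (cases "t = 0") (auto simp: field_simps add_pos_nonneg)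
  thus "\<forall>t. 0 \<le> poly (subst_poly q P) t"
    by (simp add: subst_poly(1)[OF assms])
qed

lemma poly_P_poly:
  "poly (P_poly D\<^sub>v D\<^sub>c \<epsilon> \<rho> lam) x =
    x - (\<Sum>i=2..D\<^sub>v. lam i * (1 - poly (edge_poly D\<^sub>c \<rho>) (1 - \<epsilon> * x)) ^ (i - 1))"
proof -
  have "poly (edge_poly D c) y = (\<Sum>i=2..D. c i * y ^ (i - 1))" for D c y
    by (simp add: edge_poly_def poly_sum poly_monom)
  from this[of D\<^sub>v lam] show ?thesis
    by (simp add: P_poly_def poly_pcompose mult.commute)
qed

lemma NLP1_feasible_iff:
  assumes "D\<^sub>v \<ge> 2" "D\<^sub>c \<ge> 2"
  shows "NLP1_feasible D\<^sub>v D\<^sub>c \<epsilon> \<rho> lam \<longleftrightarrow> (\<exists>B. SDP1_feasible D\<^sub>v D\<^sub>c \<epsilon> \<rho> (lam, B))"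
proof -
  note deg = degree_P_poly[OF assms, of \<epsilon> \<rho> lam]
  \<comment> \<open>(NLP1) does not state this bound; each weight is one term of a nonnegative sum
    equal to 1.\<close>
  have "lam i \<le> 1" if "i \<in> {2..D\<^sub>v}" "\<forall>i\<in>{2..D\<^sub>v}. 0 \<le> lam i" "(\<Sum>i=2..D\<^sub>v. lam i) = 1" for i
    using member_le_sum[of i "{2..D\<^sub>v}" lam] that by auto
  moreover have "(\<forall>x\<in>{0<..1}. (\<Sum>i=2..D\<^sub>v. lam i * (1 - poly (edge_poly D\<^sub>c \<rho>) (1 - \<epsilon> * x)) ^ (i - 1)) \<le> x)
      \<longleftrightarrow> (\<forall>t. 0 \<le> poly (Pi_poly D\<^sub>v D\<^sub>c \<epsilon> \<rho> lam) t)"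
    unfolding Pi_poly_def subst_poly_nonneg_iff[OF deg] by (simp add: poly_P_poly)
  ultimately show ?thesis
    unfolding NLP1_feasible_def SDP1_feasible_def
    using nonneg_poly_iff_psd_gram[OF subst_poly(2)[OF deg], folded Pi_poly_def]
    by (auto simp: Let_def)
qed

theorem theorem1:
  fixes D\<^sub>v D\<^sub>c :: nat and \<epsilon> :: real and \<rho> :: "nat \<Rightarrow> real"
  assumes "D\<^sub>v \<ge> 2" and "D\<^sub>c \<ge> 2"
    and "0 < \<epsilon>" and "\<epsilon> \<le> 1"
    and "\<forall>j\<in>{2..D\<^sub>c}. \<rho> j \<ge> 0" and "(\<Sum>j=2..D\<^sub>c. \<rho> j) = 1"
  shows "(\<forall>lam. NLP1_feasible D\<^sub>v D\<^sub>c \<epsilon> \<rho> lam \<longleftrightarrow> (\<exists>B. SDP1_feasible D\<^sub>v D\<^sub>c \<epsilon> \<rho> (lam, B))) \<and>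
    (\<forall>lam. NLP1_optimal D\<^sub>v D\<^sub>c \<epsilon> \<rho> lam \<longleftrightarrow> (\<exists>B. SDP1_optimal D\<^sub>v D\<^sub>c \<epsilon> \<rho> (lam, B)))"
  \<comment> \<open>The objective ignores \<open>B\<close>, so the same values compete in both
    programs and the maximisers correspond.\<close>
  using NLP1_feasible_iff[OF assms(1,2)]
  by (auto simp: NLP1_optimal_def SDP1_optimal_def is_arg_max_def)

end
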